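(* Let $\alpha_2>0$ be a constant. Let $H$ be a $\{1,2\}$-graph with $n$ vertices, and suppose the order of a maximum clique of $H$ is $t$, where $t\ge \alpha_2$. Then $$L_{\{\alpha_2\}}(H)=L_{\{\alpha_2\}}(K_t^{\{1,2\}})=1+\frac{\alpha_2}{2}-\frac{\alpha_2}{2t}.$$ Furthermore, the characteristic vector of a maximum clique of $H$ is a maximizer of $L_{\{\alpha_2\}}(H,\vec x)$ over $S$.
   Context: A hypergraph $H=(V,E)$ has edges that are subsets of $V$; $T(H)=\{|e|:e\in E\}$ is its set of edge types, and $H$ is called a $T(H)$-graph. A $\{1,2\}$-graph on vertex set $[n]$ thus has edges of size $1$ and size $2$ (both types present). $K_t^{\{1,2\}}$ denotes the hypergraph on $[t]$ whose edges are all $1$-subsets and all $2$-subsets of $[t]$. A clique of $H$ is a complete subhypergraph of $H$ with the same edge type set as $T(H)$, i.e. a vertex set $W$ such that every subset of $W$ of size in $T(H)$ is an edge of $H$; its order is $|W|$. Let $S=\{\vec x\in\mathbb{R}^n:\sum_i x_i=1,\ x_i\ge 0\}$. For $\vec x\in S$, $$L_{\{\alpha_2\}}(H,\vec x)=\sum_{\{i\}\in E}x_i+\alpha_2\sum_{\{i,j\}\in E}x_ix_j,\qquad L_{\{\alpha_2\}}(H)=\max_{\vec x\in S}L_{\{\alpha_2\}}(H,\vec x).$$ The characteristic vector of a set $U\subseteq[n]$ is $\vec x^U\in S$ with $x^U_i=1/|U|$ if $i\in U$ and $0$ otherwise. *)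

theory Defs
  imports Complex_Main
begin

type_synonym 'a hypergraph = "'a set \<times> 'a set set"

definition verts :: "'a hypergraph \<Rightarrow> 'a set" where
  "verts H = fst H"

definition edges :: "'a hypergraph \<Rightarrow> 'a set set" where
  "edges H = snd H"

definition hypergraph :: "'a hypergraph \<Rightarrow> bool" where
  "hypergraph H \<longleftrightarrow> finite (verts H) \<and> edges H \<subseteq> Pow (verts H)"

definition edge_types :: "'a hypergraph \<Rightarrow> nat set" where
  "edge_types H = card ` edges H"

text \<open>All the sizes in \<open>R\<close> must actually occur as edge sizes.\<close>

definition typed_graph :: "nat set \<Rightarrow> 'a hypergraph \<Rightarrow> bool" where
  "typed_graph R H \<longleftrightarrow> hypergraph H \<and> edge_types H = R"

text \<open>If \<open>R\<close> contains sizes above \<open>t\<close>, these do not occur as edge sizes: the graph on one vertex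
  with \<open>R = {1, 2}\<close> has the single edge \<open>{1}\<close>.\<close>

definition complete_hypergraph :: "nat set \<Rightarrow> nat \<Rightarrow> nat hypergraph" where
  "complete_hypergraph R t = ({1..t}, {e. e \<subseteq> {1..t} \<and> card e \<in> R})"

definition is_clique :: "'a hypergraph \<Rightarrow> 'a set \<Rightarrow> bool" where
  "is_clique H W \<longleftrightarrow>
     W \<subseteq> verts H \<and> (\<forall>e. e \<subseteq> W \<and> card e \<in> edge_types H \<longrightarrow> e \<in> edges H)"

definition is_maximum_clique :: "'a hypergraph \<Rightarrow> 'a set \<Rightarrow> bool" where
  "is_maximum_clique H W \<longleftrightarrow>
     is_clique H W \<and> (\<forall>W'. is_clique H W' \<longrightarrow> card W' \<le> card W)"

text \<open>Vectors indexed by \<open>V\<close> are functions that vanish outside \<open>V\<close>.\<close>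

definition std_simplex :: "'a set \<Rightarrow> ('a \<Rightarrow> real) set" where
  "std_simplex V = {x. (\<forall>i\<in>V. x i \<ge> 0) \<and> (\<forall>i. i \<notin> V \<longrightarrow> x i = 0) \<and> (\<Sum>i\<in>V. x i) = 1}"

text \<open>The second sum runs over unordered pairs, so each 2-edge is counted once.\<close>

definition lagrange_poly :: "real \<Rightarrow> 'a hypergraph \<Rightarrow> ('a \<Rightarrow> real) \<Rightarrow> real" where
  "lagrange_poly \<alpha> H x =
     (\<Sum>i\<in>{i\<in>verts H. {i} \<in> edges H}. x i) +
     \<alpha> * (\<Sum>e\<in>{e\<in>edges H. card e = 2}. \<Prod>i\<in>e. x i)"

text \<open>A maximum over an infinite set, hence \<open>GREATEST\<close> rather than \<open>Max\<close>.\<close>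

definition lagrangian :: "real \<Rightarrow> 'a hypergraph \<Rightarrow> real" where
  "lagrangian \<alpha> H = (GREATEST v. v \<in> lagrange_poly \<alpha> H ` std_simplex (verts H))"

definition is_maximizer :: "real \<Rightarrow> 'a hypergraph \<Rightarrow> ('a \<Rightarrow> real) \<Rightarrow> bool" where
  "is_maximizer \<alpha> H x \<longleftrightarrow> x \<in> std_simplex (verts H) \<and>
     (\<forall>y\<in>std_simplex (verts H). lagrange_poly \<alpha> H y \<le> lagrange_poly \<alpha> H x)"

definition char_vec :: "'a set \<Rightarrow> 'a \<Rightarrow> real" where
  "char_vec U i = (if i \<in> U then 1 / real (card U) else 0)"

end

(* Motzkin-Straus argument. If i and j carry positive weight and {i,j} is not an edge, then the
   polynomial is affine along the segment that trades the weight of i for that of j, so moving to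
   one of its endpoints does not decrease the value and shrinks the support. Hence the support may
   be assumed pairwise adjacent. Let a be the total weight of the vertices that are edges of
   size 1. Those of them in the support form a clique, so the sum of all x_i^2 is at least a^2/t by
   Cauchy-Schwarz, and the value is at most a + \<alpha>/2 - \<alpha> a^2/(2t). For \<alpha> \<le> t this is increasing
   in a on [0,1], and a = 1 gives the bound, which the characteristic vector of a maximum clique
   attains. *)

theory Submission
  imports Defs "HOL-Analysis.Convex"
begin

section \<open>Squares and unordered pairs\<close>

text \<open>On the simplex the left side is 1, so the sum over all pairs becomes half of 1 minus the
  sum of squares. This serves both the upper bound and the value at a characteristic vector.\<close>

lemma sum_squared_eq_pairs:
  fixes x :: "'a \<Rightarrow> real"
  assumes "finite V"
  shows "(\<Sum>i\<in>V. x i)\<^sup>2 = (\<Sum>i\<in>V. (x i)\<^sup>2) + 2 * (\<Sum>e\<in>{e. e \<subseteq> V \<and> card e = 2}. \<Prod>i\<in>e. x i)"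
  using assms
proof (induction V rule: finite_induct)
  case empty
  have no_pairs: "{e. e \<subseteq> ({}::'a set) \<and> card e = 2} = {}" by auto
  show ?case by (simp only: no_pairs) simp
next
  case (insert v V)
  have pairs: "{e. e \<subseteq> insert v V \<and> card e = 2} =
      {e. e \<subseteq> V \<and> card e = 2} \<union> (\<lambda>w. {v, w}) ` V" (is "?L = ?R")
  proof
    show "?L \<subseteq> ?R"
      by (auto simp: card_2_iff)
    show "?R \<subseteq> ?L"
      using insert.hyps by (auto simp: card_2_iff)
  qed
  have fin: "finite {e. e \<subseteq> V \<and> card e = 2}"
    using insert.hyps by simp
  have disj: "{e. e \<subseteq> V \<and> card e = 2} \<inter> (\<lambda>w. {v, w}) ` V = {}"
    using insert.hyps by auto
  have inj: "inj_on (\<lambda>w. {v, w}) V"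
    by (auto simp: inj_on_def doubleton_eq_iff)
  have "(\<Sum>e\<in>(\<lambda>w. {v, w}) ` V. \<Prod>i\<in>e. x i) = (\<Sum>w\<in>V. \<Prod>i\<in>{v, w}. x i)"
    using inj by (simp add: sum.reindex)
  also have "\<dots> = (\<Sum>w\<in>V. x v * x w)"
    using insert.hyps by (intro sum.cong refl prod.insert[THEN trans]) auto
  also have "\<dots> = x v * (\<Sum>w\<in>V. x w)"
    by (simp add: sum_distrib_left)
  finally have "(\<Sum>e\<in>{e. e \<subseteq> insert v V \<and> card e = 2}. \<Prod>i\<in>e. x i) =
      (\<Sum>e\<in>{e. e \<subseteq> V \<and> card e = 2}. \<Prod>i\<in>e. x i) + x v * (\<Sum>w\<in>V. x w)"
    unfolding pairs using fin disj insert.hyps by (simp add: sum.union_disjoint)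
  then show ?case
    using insert by (simp add: power2_eq_square algebra_simps)
qed

section \<open>Trading weight between two vertices\<close>

lemma finite_edges: "hypergraph H \<Longrightarrow> finite (edges H)"
  by (meson finite_Pow_iff hypergraph_def rev_finite_subset)

text \<open>The point \<open>x\<close> is the mean of the two endpoints with weights proportional to
  \<open>x i\<close> and \<open>x j\<close>, and a monomial with at most one of the two variables is
  affine between them. Multiplying by \<open>x i + x j\<close> avoids division.\<close>

lemma prod_upd_affine:
  fixes x :: "'a \<Rightarrow> real"
  assumes "finite e" "i \<noteq> j" "\<not> {i, j} \<subseteq> e" "x i + x j > 0"
  shows "(x i + x j) * (\<Prod>k\<in>e. x k) =
      x i * (\<Prod>k\<in>e. (x(i := x i + x j, j := 0)) k) +
      x j * (\<Prod>k\<in>e. (x(i := 0, j := x i + x j)) k)"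
proof -
  consider "i \<in> e" "j \<notin> e" | "i \<notin> e" "j \<in> e" | "i \<notin> e" "j \<notin> e"
    using assms by auto
  then show ?thesis
  proof cases
    case 1
    \<comment> \<open>Only the factor at \<open>i\<close> changes: it is \<open>x i + x j\<close> at
      the first endpoint and 0 at the second. The remaining product is common to both.\<close>
    have "(\<Prod>k\<in>e - {i}. (x(i := s, j := r)) k) = (\<Prod>k\<in>e - {i}. x k)" for s r
      using 1 by (intro prod.cong) auto
    then show ?thesis
      using 1 assms by (simp add: prod.remove[of e i])
  next
    case 2
    have "(\<Prod>k\<in>e - {j}. (x(i := s, j := r)) k) = (\<Prod>k\<in>e - {j}. x k)" for s r
      using 2 by (intro prod.cong) auto
    then show ?thesis
      using 2 assms by (simp add: prod.remove[of e j])
  next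
    case 3
    have "(\<Prod>k\<in>e. (x(i := s, j := r)) k) = (\<Prod>k\<in>e. x k)" for s r
      using 3 by (intro prod.cong) auto
    then show ?thesis
      by (simp add: algebra_simps)
  qed
qed

text \<open>No monomial contains both variables: a singleton cannot, and a 2-edge that did would be
  \<open>{i, j}\<close>.\<close>

lemma lagrange_poly_upd_affine:
  assumes "hypergraph H" "i \<noteq> j" "{i, j} \<notin> edges H" "x i + x j > 0"
  shows "(x i + x j) * lagrange_poly \<alpha> H x =
      x i * lagrange_poly \<alpha> H (x(i := x i + x j, j := 0)) +
      x j * lagrange_poly \<alpha> H (x(i := 0, j := x i + x j))"
proof -
  let ?y = "x(i := x i + x j, j := 0)" and ?z = "x(i := 0, j := x i + x j)"
  let ?A = "{i \<in> verts H. {i} \<in> edges H}" and ?E = "{e \<in> edges H. card e = 2}"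
  have vertex: "(x i + x j) * x k = x i * ?y k + x j * ?z k" for k
    using prod_upd_affine[of "{k}" i j x] assms by auto
  have edge: "(x i + x j) * (\<Prod>k\<in>e. x k) = x i * (\<Prod>k\<in>e. ?y k) + x j * (\<Prod>k\<in>e. ?z k)"
    if "e \<in> ?E" for e
  proof (rule prod_upd_affine)
    show fin: "finite e"
      using that by (auto intro: card_ge_0_finite)
    show "\<not> {i, j} \<subseteq> e"
    proof
      assume "{i, j} \<subseteq> e"
      then have "{i, j} = e"
        using that fin assms(2) by (intro card_subset_eq) auto
      then show False
        using that assms(3) by auto
    qed
  qed (use assms in auto)
  have "(x i + x j) * sum x ?A = x i * sum ?y ?A + x j * sum ?z ?A"
    unfolding sum_distrib_left sum.distrib[symmetric] by (intro sum.cong refl vertex)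
  moreover have "(x i + x j) * (\<Sum>e\<in>?E. \<Prod>k\<in>e. x k) =
      x i * (\<Sum>e\<in>?E. \<Prod>k\<in>e. ?y k) + x j * (\<Sum>e\<in>?E. \<Prod>k\<in>e. ?z k)"
    unfolding sum_distrib_left sum.distrib[symmetric] by (intro sum.cong refl edge)
  moreover have "(x i + x j) * lagrange_poly \<alpha> H x =
      (x i + x j) * sum x ?A + \<alpha> * ((x i + x j) * (\<Sum>e\<in>?E. \<Prod>k\<in>e. x k))"
    unfolding lagrange_poly_def by (simp add: algebra_simps)
  ultimately show ?thesis
    unfolding lagrange_poly_def by (simp only:) (simp only: algebra_simps)
qed

lemma std_simplex_upd:
  assumes "finite V" "x \<in> std_simplex V" "i \<in> V" "j \<in> V" "i \<noteq> j"
    and "p \<ge> 0" "q \<ge> 0" "p + q = x i + x j"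
  shows "x(i := p, j := q) \<in> std_simplex V"
proof -
  have split: "sum f V = f i + (f j + sum f (V - {i} - {j}))" for f :: "'a \<Rightarrow> real"
    using assms by (simp add: sum.remove[of V i] sum.remove[of "V - {i}" j])
  have "sum (x(i := p, j := q)) (V - {i} - {j}) = sum x (V - {i} - {j})"
    by (intro sum.cong) auto
  then have "sum (x(i := p, j := q)) V = sum x V"
    using assms split[of x] split[of "x(i := p, j := q)"] by simp
  then show ?thesis
    using assms by (auto simp: std_simplex_def)
qed

section \<open>Cliques and the upper bound\<close>

text \<open>The sizes are a parameter because the complete hypergraph for \<open>t = 1\<close> has
  no 2-edges, so its \<open>edge_types\<close> is \<open>{1}\<close>. With \<open>R = {1, 2}\<close>
  fixed, the same bound covers this case and \<open>H\<close>.\<close>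

definition clique_on :: "nat set \<Rightarrow> 'a hypergraph \<Rightarrow> 'a set \<Rightarrow> bool" where
  "clique_on R H W \<longleftrightarrow> W \<subseteq> verts H \<and> (\<forall>e. e \<subseteq> W \<and> card e \<in> R \<longrightarrow> e \<in> edges H)"

lemma is_clique_iff_clique_on: "is_clique H W \<longleftrightarrow> clique_on (edge_types H) H W"
  by (simp add: is_clique_def clique_on_def)

lemma lagrange_poly_le_of_adjacent_support:
  assumes "hypergraph H" "\<alpha> > 0" "real t \<ge> \<alpha>"
    and cl: "\<And>W. clique_on {1, 2} H W \<Longrightarrow> card W \<le> t"
    and x: "x \<in> std_simplex (verts H)"
    and adj: "\<And>i j. x i \<noteq> 0 \<Longrightarrow> x j \<noteq> 0 \<Longrightarrow> i \<noteq> j \<Longrightarrow> {i, j} \<in> edges H"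
  shows "lagrange_poly \<alpha> H x \<le> 1 + \<alpha> / 2 - \<alpha> / (2 * real t)"
proof -
  let ?V = "verts H"
  define A where "A = {i \<in> ?V. {i} \<in> edges H}"
  define W where "W = {i \<in> A. x i \<noteq> 0}"
  define a where "a = sum x A"
  define q where "q = (\<Sum>i\<in>?V. (x i)\<^sup>2)"
  have fV: "finite ?V"
    using assms(1) by (simp add: hypergraph_def)
  have fA: "finite A" and AV: "A \<subseteq> ?V" and WA: "W \<subseteq> A"
    using fV by (auto simp: A_def W_def)
  have nonneg: "x i \<ge> 0" for i
    using x by (cases "i \<in> ?V") (auto simp: std_simplex_def)
  have sum1: "sum x ?V = 1"
    using x by (simp add: std_simplex_def)
  have t: "real t > 0"
    using assms by linarith
  have "clique_on {1, 2} H W"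
    using AV WA adj by (auto simp: clique_on_def W_def A_def card_1_singleton_iff card_2_iff)
  then have cW: "card W \<le> t"
    by (rule cl)
  have aW: "a = sum x W"
    unfolding a_def W_def using fA by (intro sum.mono_neutral_right) auto
  have "a\<^sup>2 \<le> card W * (\<Sum>i\<in>W. (x i)\<^sup>2)"
    unfolding aW using sum_squared_le_sum_of_squares[of x W] by (simp add: mult.commute)
  also have "\<dots> \<le> t * q"
    unfolding q_def using cW WA AV fV
    by (intro mult_mono sum_mono2) (auto intro: sum_nonneg)
  finally have aq: "a\<^sup>2 / t \<le> q"
    using t by (simp add: field_simps)
  have a: "a \<le> 1" "a \<ge> 0"
    unfolding a_def using sum_mono2[OF fV AV, of x] sum1 nonneg by (auto intro: sum_nonneg)
  have sub: "{e \<in> edges H. card e = 2} \<subseteq> {e. e \<subseteq> ?V \<and> card e = 2}"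
    using assms(1) by (auto simp: hypergraph_def)
  \<comment> \<open>Adding the missing pairs only increases the sum, since all products are
    nonnegative.\<close>
  have "(\<Sum>e\<in>{e \<in> edges H. card e = 2}. \<Prod>i\<in>e. x i) \<le>
      (\<Sum>e\<in>{e. e \<subseteq> ?V \<and> card e = 2}. \<Prod>i\<in>e. x i)"
    using sub fV nonneg by (intro sum_mono2) (auto intro: prod_nonneg)
  also have "\<dots> = (1 - q) / 2"
    using sum_squared_eq_pairs[OF fV, of x] sum1 by (simp add: q_def)
  also have "\<dots> \<le> (1 - a\<^sup>2 / t) / 2"
    by (intro divide_right_mono diff_left_mono aq) simp
  finally have "lagrange_poly \<alpha> H x \<le> a + \<alpha> * ((1 - a\<^sup>2 / t) / 2)"
    unfolding lagrange_poly_def a_def A_def using assms(2) by (simp add: mult_left_mono)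
  \<comment> \<open>The quadratic in \<open>a\<close> takes the target value at
    \<open>a = 1\<close>, so its deficit has the factor \<open>1 - a\<close>. The cofactor is
    nonnegative because \<alpha> \<le> \<open>t\<close> and \<open>1 + a\<close> \<le> 2.\<close>
  also have "\<dots> = 1 + \<alpha> / 2 - \<alpha> / (2 * real t) - (1 - a) * (1 - \<alpha> * (1 + a) / (2 * real t))"
    using t by (simp add: field_simps power2_eq_square)
  also have "\<dots> \<le> 1 + \<alpha> / 2 - \<alpha> / (2 * real t)"
  proof -
    have "\<alpha> * (1 + a) \<le> real t * 2"
      using assms a by (intro mult_mono) auto
    then show ?thesis
      using t a by simp
  qed
  finally show ?thesis .
qed

text \<open>Induction on the size of the support. Both endpoints of a trade have smaller support, so
  both obey the bound, and hence so does their weighted mean; the better endpoint need not be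
  singled out.\<close>

lemma lagrange_poly_le:
  assumes "hypergraph H" "\<alpha> > 0" "real t \<ge> \<alpha>"
    and "\<And>W. clique_on {1, 2} H W \<Longrightarrow> card W \<le> t"
    and "x \<in> std_simplex (verts H)"
  shows "lagrange_poly \<alpha> H x \<le> 1 + \<alpha> / 2 - \<alpha> / (2 * real t)"
  using assms(5)
proof (induction "card {i. x i \<noteq> 0}" arbitrary: x rule: less_induct)
  case less
  let ?M = "1 + \<alpha> / 2 - \<alpha> / (2 * real t)"
  have fV: "finite (verts H)"
    using assms(1) by (simp add: hypergraph_def)
  have supp: "{i. x i \<noteq> 0} \<subseteq> verts H"
    using less.prems by (auto simp: std_simplex_def)
  show ?case
  proof (cases "\<forall>i j. x i \<noteq> 0 \<longrightarrow> x j \<noteq> 0 \<longrightarrow> i \<noteq> j \<longrightarrow> {i, j} \<in> edges H")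
    case True
    show ?thesis
      by (rule lagrange_poly_le_of_adjacent_support[OF assms(1-4) less.prems]) (use True in auto)
  next
    case False
    then obtain i j where ij: "x i \<noteq> 0" "x j \<noteq> 0" "i \<noteq> j" "{i, j} \<notin> edges H"
      by auto
    have V: "i \<in> verts H" "j \<in> verts H"
      using ij supp by auto
    have pos: "x i > 0" "x j > 0"
      using ij V less.prems by (auto simp: std_simplex_def order_le_less)
    let ?y = "x(i := x i + x j, j := 0)" and ?z = "x(i := 0, j := x i + x j)"
    have "?y \<in> std_simplex (verts H)" "?z \<in> std_simplex (verts H)"
      using fV less.prems V ij pos by (auto intro!: std_simplex_upd)
    \<comment> \<open>The vertex \<open>j\<close> leaves the support in \<open>?y\<close> and
      \<open>i\<close> leaves it in \<open>?z\<close>; no vertex enters.\<close>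
    moreover have "card {k. ?y k \<noteq> 0} < card {k. x k \<noteq> 0}" "card {k. ?z k \<noteq> 0} < card {k. x k \<noteq> 0}"
      using ij by (auto intro!: psubset_card_mono finite_subset[OF supp fV] split: if_splits)
    ultimately have y: "lagrange_poly \<alpha> H ?y \<le> ?M" and z: "lagrange_poly \<alpha> H ?z \<le> ?M"
      using less.hyps by blast+
    have "(x i + x j) * lagrange_poly \<alpha> H x = x i * lagrange_poly \<alpha> H ?y + x j * lagrange_poly \<alpha> H ?z"
      using assms(1) ij pos by (intro lagrange_poly_upd_affine) auto
    also have "\<dots> \<le> x i * ?M + x j * ?M"
      using y z pos by (intro add_mono mult_left_mono) auto
    also have "\<dots> = (x i + x j) * ?M"
      by (simp only: distrib_right)
    finally show ?thesis
      using pos by (metis add_pos_pos mult_le_cancel_left_pos)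
  qed
qed

section \<open>Values at characteristic vectors\<close>

lemma char_vec_in_std_simplex:
  assumes "finite V" "U \<subseteq> V" "U \<noteq> {}"
  shows "char_vec U \<in> std_simplex V"
proof -
  have "sum (char_vec U) V = sum (char_vec U) U"
    using assms by (intro sum.mono_neutral_right) (auto simp: char_vec_def)
  also have "\<dots> = 1"
    using assms finite_subset[OF assms(2,1)] by (simp add: char_vec_def)
  finally show ?thesis
    using assms by (auto simp: std_simplex_def char_vec_def)
qed

text \<open>All weight sits on vertices with a singleton edge, giving 1, and every pair inside
  \<open>U\<close> is an edge, so the pair identity applies with sum of squares
  \<open>1 / card U\<close>.\<close>

lemma lagrange_poly_char_vec:
  assumes "hypergraph H" "clique_on {1, 2} H U" "U \<noteq> {}"
  shows "lagrange_poly \<alpha> H (char_vec U) = 1 + \<alpha> / 2 - \<alpha> / (2 * real (card U))"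
proof -
  let ?x = "char_vec U"
  have fV: "finite (verts H)"
    using assms(1) by (simp add: hypergraph_def)
  have UV: "U \<subseteq> verts H"
    using assms(2) by (simp add: clique_on_def)
  have fU: "finite U"
    using UV fV by (rule finite_subset)
  have c: "real (card U) > 0"
    using fU assms(3) by (simp add: card_gt_0_iff)
  have sumU: "sum ?x U = 1"
    using c by (simp add: char_vec_def)
  have "sum ?x {i \<in> verts H. {i} \<in> edges H} = sum ?x U"
    using assms(2) fV by (intro sum.mono_neutral_right) (auto simp: clique_on_def char_vec_def)
  then have loops: "sum ?x {i \<in> verts H. {i} \<in> edges H} = 1"
    using sumU by simp
  have "(\<Sum>e\<in>{e \<in> edges H. card e = 2}. \<Prod>i\<in>e. ?x i) =
      (\<Sum>e\<in>{e. e \<subseteq> U \<and> card e = 2}. \<Prod>i\<in>e. ?x i)"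
  proof (intro sum.mono_neutral_right ballI)
    \<comment> \<open>A 2-edge not inside \<open>U\<close> has an endpoint of weight 0.\<close>
    fix e assume e: "e \<in> {e \<in> edges H. card e = 2} - {e. e \<subseteq> U \<and> card e = 2}"
    then have "finite e" "\<exists>i\<in>e. ?x i = 0"
      by (auto simp: char_vec_def intro: card_ge_0_finite)
    then show "(\<Prod>i\<in>e. ?x i) = 0"
      by (simp add: prod_zero)
  qed (use assms(2) finite_edges[OF assms(1)] in \<open>auto simp: clique_on_def\<close>)
  also have "\<dots> = (1 - (\<Sum>i\<in>U. (?x i)\<^sup>2)) / 2"
    using sum_squared_eq_pairs[OF fU, of ?x] sumU by simp
  also have "(\<Sum>i\<in>U. (?x i)\<^sup>2) = 1 / card U"
    using c by (simp add: char_vec_def power2_eq_square)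
  finally have pairs: "(\<Sum>e\<in>{e \<in> edges H. card e = 2}. \<Prod>i\<in>e. ?x i) = (1 - 1 / card U) / 2" .
  show ?thesis
    unfolding lagrange_poly_def loops pairs using c by (simp add: field_simps)
qed

section \<open>Attainment and the value of the Lagrangian\<close>

text \<open>\<open>GREATEST\<close> is determined once a greatest element is exhibited; a maximizer
  supplies one.\<close>

lemma lagrangian_eq_maximizer:
  assumes "is_maximizer \<alpha> H x"
  shows "lagrangian \<alpha> H = lagrange_poly \<alpha> H x"
  unfolding lagrangian_def
  using assms by (intro Greatest_equality) (auto simp: is_maximizer_def)

lemma char_vec_is_maximizer:
  assumes "hypergraph H" "\<alpha> > 0" "real (card U) \<ge> \<alpha>" "clique_on {1, 2} H U"
    and "\<And>W. clique_on {1, 2} H W \<Longrightarrow> card W \<le> card U"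
  shows "is_maximizer \<alpha> H (char_vec U)"
    and "lagrangian \<alpha> H = 1 + \<alpha> / 2 - \<alpha> / (2 * real (card U))"
proof -
  \<comment> \<open>The empty set has order 0, which is below \<alpha>.\<close>
  have ne: "U \<noteq> {}"
    using assms(2,3) by auto
  have "char_vec U \<in> std_simplex (verts H)"
    using assms(1,4) ne by (intro char_vec_in_std_simplex) (auto simp: hypergraph_def clique_on_def)
  then show max: "is_maximizer \<alpha> H (char_vec U)"
    unfolding is_maximizer_def lagrange_poly_char_vec[OF assms(1,4) ne]
    using lagrange_poly_le[OF assms(1-3,5)] by blast
  show "lagrangian \<alpha> H = 1 + \<alpha> / 2 - \<alpha> / (2 * real (card U))"
    unfolding lagrangian_eq_maximizer[OF max] by (rule lagrange_poly_char_vec[OF assms(1,4) ne])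
qed

text \<open>The whole vertex set is a clique of largest order, so the general value applies to
  it.\<close>

lemma lagrangian_complete:
  assumes "\<alpha> > 0" "real t \<ge> \<alpha>"
  shows "lagrangian \<alpha> (complete_hypergraph {1, 2} t) = 1 + \<alpha> / 2 - \<alpha> / (2 * real t)"
proof -
  have "clique_on {1, 2} (complete_hypergraph {1, 2} t) {1..t}"
    by (auto simp: clique_on_def complete_hypergraph_def verts_def edges_def)
  moreover have "card W \<le> card {1..t}" if "clique_on {1, 2} (complete_hypergraph {1, 2} t) W" for W
    using that by (intro card_mono) (auto simp: clique_on_def complete_hypergraph_def verts_def)
  moreover have "hypergraph (complete_hypergraph {1, 2} t)"
    by (auto simp: hypergraph_def complete_hypergraph_def verts_def edges_def)
  ultimately show ?thesis
    using char_vec_is_maximizer(2)[of "complete_hypergraph {1, 2} t" \<alpha> "{1..t}"] assms by simp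
qed

theorem theorem6:
  fixes \<alpha> :: real and H :: "nat hypergraph" and n t :: nat
  assumes "\<alpha> > 0"
    and "typed_graph {1, 2} H"
    and "verts H = {1..n}"
    and "\<exists>W. is_maximum_clique H W \<and> card W = t"
    and "real t \<ge> \<alpha>"
  shows "lagrangian \<alpha> H = lagrangian \<alpha> (complete_hypergraph {1, 2} t)
    \<and> lagrangian \<alpha> (complete_hypergraph {1, 2} t) = 1 + \<alpha> / 2 - \<alpha> / (2 * real t)
    \<and> (\<forall>U. is_maximum_clique H U \<longrightarrow> is_maximizer \<alpha> H (char_vec U))"
proof -
  have H: "hypergraph H" and types: "edge_types H = {1, 2}"
    using assms(2) by (auto simp: typed_graph_def)
  obtain W where W: "is_maximum_clique H W" "card W = t"
    using assms(4) by auto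
  have max: "is_maximizer \<alpha> H (char_vec U)"
    "lagrangian \<alpha> H = 1 + \<alpha> / 2 - \<alpha> / (2 * real t)" if "is_maximum_clique H U" for U
  proof -
    \<comment> \<open>Any two maximum cliques bound each other's order.\<close>
    have card: "card U = t"
      using that W by (metis is_maximum_clique_def le_antisym)
    have "clique_on {1, 2} H U" "\<And>W'. clique_on {1, 2} H W' \<Longrightarrow> card W' \<le> card U"
      using that unfolding is_maximum_clique_def is_clique_iff_clique_on types by auto
    then show "is_maximizer \<alpha> H (char_vec U)"
      "lagrangian \<alpha> H = 1 + \<alpha> / 2 - \<alpha> / (2 * real t)"
      using char_vec_is_maximizer[OF H assms(1), of U] assms(5) card by auto
  qed
  show ?thesis
    using max W(1) lagrangian_complete[OF assms(1,5)] by simp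
qed

end
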